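(* Let $\mathbb{X}$ be a real reflexive Banach space with dual $\mathbb{X}^*$, and let $g:\mathbb{X}\to\mathbb{R}$ be proper, convex, lower semicontinuous, uniformly Fréchet differentiable, $\gamma$-strongly convex for some $\gamma>0$, strongly coercive and Legendre. Let $\mathcal{A}:\mathbb{X}\to\mathbb{X}^*$ be Lipschitz continuous with constant $L>0$ and let $\mathcal{B}:\mathbb{X}\to 2^{\mathbb{X}^*}$, and suppose that for some $\tau>0$ one of the following holds: (i) $\mathcal{A}$ is monotone and $\mathcal{B}$ is maximal monotone and $\tau$-strongly monotone; or (ii) $\mathcal{A}$ is $\tau$-strongly monotone and $\mathcal{B}$ is maximal monotone. Assume that $(\mathcal{A}+\mathcal{B})^{-1}(0^* ):=\{v\in\mathbb{X}: 0^*\in \mathcal{A}v+\mathcal{B}v\}\neq\emptyset$. Let $\delta\in(0,\frac12)$ and let $\mu\in\left[\delta,\frac{\gamma(1-2\delta)}{2L}\right]$. For arbitrary $v_0,v_1\in\mathbb{X}$ define $$v_{n+1}=\mathrm{Res}^g_{\mu\mathcal{B}}\Big(\nabla g^*\big(\nabla g(v_n)-\mu(2\mathcal{A}v_n-\mathcal{A}v_{n-1})\big)\Big),\quad n\geq 1.$$ Then the sequence $\{v_n\}$ converges strongly (in norm) to some $u\in(\mathcal{A}+\mathcal{B})^{-1}(0^* )$.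
   Context: $0^*$ is the zero of $\mathbb{X}^*$. $g^*(x^* )=\sup_{x\in\mathbb{X}}\{\langle x^*,x\rangle-g(x)\}$ is the Fenchel conjugate of $g$. Conditions on $g$: $g$ is uniformly Fréchet differentiable if the limit $\langle\nabla g(x),y\rangle=\lim_{\lambda\to0}\frac{g(x+\lambda y)-g(x)}{\lambda}$ is attained uniformly for $x\in\mathbb{X}$ and $\|y\|=1$. $g$ is $\gamma$-strongly convex if $\langle\nabla g(x)-\nabla g(y),x-y\rangle\ge\gamma\|x-y\|^2$ for all $x,y$. $g$ is strongly coercive if $g(x)/\|x\|\to+\infty$ as $\|x\|\to\infty$. $g$ is Legendre if $g$ and $g^*$ are Gâteaux differentiable on the interiors of their domains, these interiors are nonempty, and the domains of $\nabla g$ and $\nabla g^*$ equal $\mathrm{int}(\mathrm{dom}\, g)$ and $\mathrm{int}(\mathrm{dom}\, g^* )$ respectively. Under these conditions $\nabla g:\mathbb{X}\to\mathbb{X}^*$ is a bijection, $\mathrm{dom}\,g^*=\mathbb{X}^*$ and $\nabla g^*=(\nabla g)^{-1}$. Resolvent: for $\mu>0$, $\mathrm{Res}^g_{\mu\mathcal{B}}:=(\nabla g+\mu\mathcal{B})^{-1}\circ\nabla g$, which is single-valued and everywhere defined for $\mathcal{B}$ maximal monotone. $\mathcal{A}$ is monotone (resp. $\tau$-strongly monotone) if $\langle\mathcal{A}x-\mathcal{A}y,x-y\rangle\ge0$ (resp. $\ge\tau\|x-y\|^2$) for all $x,y$. $\mathcal{B}$ is monotone (resp. $\tau$-strongly monotone)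 if $\langle u-v,x-y\rangle\ge 0$ (resp. $\ge\tau\|x-y\|^2$) whenever $u\in\mathcal{B}x$, $v\in\mathcal{B}y$, and maximal monotone if it is monotone and its graph is not properly contained in the graph of another monotone operator. *)

theory Defs
  imports "HOL-Analysis.Analysis"
begin

section \<open>Duality\<close>

text \<open>The topological dual of \<open>'a\<close> is \<open>'a \<Rightarrow>\<^sub>L real\<close> with the operator norm.\<close>

definition bidual_embedding ::
    "'a::real_normed_vector \<Rightarrow> (('a \<Rightarrow>\<^sub>L real) \<Rightarrow>\<^sub>L real)" where
  "bidual_embedding x = Blinfun (\<lambda>h. blinfun_apply h x)"

lemma bidual_embedding_apply [simp]:
  "blinfun_apply (bidual_embedding x) h = blinfun_apply h x"
  unfolding bidual_embedding_def
  by (simp add: bounded_linear_Blinfun_apply blinfun.bounded_linear_left)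

definition reflexive_space :: "'a::real_normed_vector itself \<Rightarrow> bool" where
  "reflexive_space _ \<longleftrightarrow>
     surj (bidual_embedding :: 'a \<Rightarrow> (('a \<Rightarrow>\<^sub>L real) \<Rightarrow>\<^sub>L real))"

section \<open>Extended-real-valued functions\<close>

definition effective_domain :: "('b \<Rightarrow> ereal) \<Rightarrow> 'b set" where
  "effective_domain f = {x. f x < \<infinity>}"

definition proper_function :: "('b \<Rightarrow> ereal) \<Rightarrow> bool" where
  "proper_function f \<longleftrightarrow> effective_domain f \<noteq> {} \<and> (\<forall>x. f x \<noteq> -\<infinity>)"

definition lower_semicontinuous :: "('b::topological_space \<Rightarrow> ereal) \<Rightarrow> bool" where
  "lower_semicontinuous f \<longleftrightarrow> (\<forall>x. f x \<le> Liminf (at x) f)"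

definition fenchel_conjugate ::
    "('b::real_normed_vector \<Rightarrow> ereal) \<Rightarrow> ('b \<Rightarrow>\<^sub>L real) \<Rightarrow> ereal" where
  "fenchel_conjugate f xs = (SUP x. ereal (blinfun_apply xs x) - f x)"

text \<open>The difference quotient is taken in the extended reals, where it is infinite for all
  small \<open>t \<noteq> 0\<close> along which \<open>f x\<close> or \<open>f (x + t y)\<close> is infinite; hence a Gateaux derivative can
  only exist at points where \<open>f\<close> is finite.\<close>

definition has_gateaux_derivative ::
    "('b::real_normed_vector \<Rightarrow> ereal) \<Rightarrow> ('b \<Rightarrow>\<^sub>L real) \<Rightarrow> 'b \<Rightarrow> bool" where
  "has_gateaux_derivative f D x \<longleftrightarrow>
     (\<forall>y. ((\<lambda>t::real. (f (x + t *\<^sub>R y) - f x) / ereal t)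
            \<longlongrightarrow> ereal (blinfun_apply D y)) (at 0))"

definition gateaux_differentiable_at ::
    "('b::real_normed_vector \<Rightarrow> ereal) \<Rightarrow> 'b \<Rightarrow> bool" where
  "gateaux_differentiable_at f x \<longleftrightarrow> (\<exists>D. has_gateaux_derivative f D x)"

definition gradient :: "('b::real_normed_vector \<Rightarrow> ereal) \<Rightarrow> 'b \<Rightarrow> ('b \<Rightarrow>\<^sub>L real)" where
  "gradient f x = (THE D. has_gateaux_derivative f D x)"

definition gradient_domain :: "('b::real_normed_vector \<Rightarrow> ereal) \<Rightarrow> 'b set" where
  "gradient_domain f = {x. gateaux_differentiable_at f x}"

definition legendre :: "('b::real_normed_vector \<Rightarrow> ereal) \<Rightarrow> bool" where
  "legendre f \<longleftrightarrow>
     interior (effective_domain f) \<noteq> {} \<and>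
     (\<forall>x \<in> interior (effective_domain f). gateaux_differentiable_at f x) \<and>
     gradient_domain f = interior (effective_domain f) \<and>
     interior (effective_domain (fenchel_conjugate f)) \<noteq> {} \<and>
     (\<forall>xs \<in> interior (effective_domain (fenchel_conjugate f)).
        gateaux_differentiable_at (fenchel_conjugate f) xs) \<and>
     gradient_domain (fenchel_conjugate f) = interior (effective_domain (fenchel_conjugate f))"

section \<open>Conditions on a finite-valued function\<close>

abbreviation grad :: "('a::real_normed_vector \<Rightarrow> real) \<Rightarrow> 'a \<Rightarrow> ('a \<Rightarrow>\<^sub>L real)" where
  "grad g \<equiv> gradient (\<lambda>x. ereal (g x))"

text \<open>The gradient of the conjugate is an element of the bidual; it is read as a point of the
  (reflexive) space itself through the canonical embedding.\<close>

definition grad_conj :: "('a::real_normed_vector \<Rightarrow> real) \<Rightarrow> ('a \<Rightarrow>\<^sub>L real) \<Rightarrow> 'a" where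
  "grad_conj g xs =
     inv bidual_embedding (gradient (fenchel_conjugate (\<lambda>x. ereal (g x))) xs)"

definition uniformly_frechet_differentiable :: "('a::real_normed_vector \<Rightarrow> real) \<Rightarrow> bool" where
  "uniformly_frechet_differentiable g \<longleftrightarrow>
     (\<forall>x. gateaux_differentiable_at (\<lambda>x. ereal (g x)) x) \<and>
     uniform_limit (UNIV \<times> sphere 0 1)
       (\<lambda>t (x, y). (g (x + t *\<^sub>R y) - g x) / t)
       (\<lambda>(x, y). blinfun_apply (grad g x) y)
       (at 0)"

definition strongly_convex :: "real \<Rightarrow> ('a::real_normed_vector \<Rightarrow> real) \<Rightarrow> bool" where
  "strongly_convex \<gamma> g \<longleftrightarrow>
     (\<forall>x y. blinfun_apply (grad g x - grad g y) (x - y) \<ge> \<gamma> * (norm (x - y))\<^sup>2)"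

definition strongly_coercive :: "('a::real_normed_vector \<Rightarrow> real) \<Rightarrow> bool" where
  "strongly_coercive g \<longleftrightarrow> filterlim (\<lambda>x. g x / norm x) at_top at_infinity"

section \<open>Operators into the dual\<close>

definition monotone_mapping :: "('a::real_normed_vector \<Rightarrow> ('a \<Rightarrow>\<^sub>L real)) \<Rightarrow> bool" where
  "monotone_mapping A \<longleftrightarrow> (\<forall>x y. blinfun_apply (A x - A y) (x - y) \<ge> 0)"

definition strongly_monotone_mapping ::
    "real \<Rightarrow> ('a::real_normed_vector \<Rightarrow> ('a \<Rightarrow>\<^sub>L real)) \<Rightarrow> bool" where
  "strongly_monotone_mapping \<tau> A \<longleftrightarrow>
     (\<forall>x y. blinfun_apply (A x - A y) (x - y) \<ge> \<tau> * (norm (x - y))\<^sup>2)"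

definition monotone_operator :: "('a::real_normed_vector \<Rightarrow> ('a \<Rightarrow>\<^sub>L real) set) \<Rightarrow> bool" where
  "monotone_operator B \<longleftrightarrow>
     (\<forall>x y. \<forall>u \<in> B x. \<forall>v \<in> B y. blinfun_apply (u - v) (x - y) \<ge> 0)"

definition strongly_monotone_operator ::
    "real \<Rightarrow> ('a::real_normed_vector \<Rightarrow> ('a \<Rightarrow>\<^sub>L real) set) \<Rightarrow> bool" where
  "strongly_monotone_operator \<tau> B \<longleftrightarrow>
     (\<forall>x y. \<forall>u \<in> B x. \<forall>v \<in> B y. blinfun_apply (u - v) (x - y) \<ge> \<tau> * (norm (x - y))\<^sup>2)"

definition operator_graph :: "('a \<Rightarrow> 'c set) \<Rightarrow> ('a \<times> 'c) set" where
  "operator_graph B = {(x, u). u \<in> B x}"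

definition maximal_monotone :: "('a::real_normed_vector \<Rightarrow> ('a \<Rightarrow>\<^sub>L real) set) \<Rightarrow> bool" where
  "maximal_monotone B \<longleftrightarrow>
     monotone_operator B \<and>
     \<not> (\<exists>C. monotone_operator C \<and> operator_graph B \<subset> operator_graph C)"

text \<open>\<open>zeros_of_sum A B\<close> is $(A+B)^{-1}(0)$.\<close>

definition zeros_of_sum ::
    "('a::real_normed_vector \<Rightarrow> ('a \<Rightarrow>\<^sub>L real)) \<Rightarrow> ('a \<Rightarrow> ('a \<Rightarrow>\<^sub>L real) set) \<Rightarrow> 'a set" where
  "zeros_of_sum A B = {v. 0 \<in> (\<lambda>b. A v + b) ` B v}"

text \<open>The set-valued map $(\nabla g + \mu B)^{-1} \circ \nabla g$, and the point map it determines
  where its value is a singleton (elsewhere the point map is unspecified).\<close>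

definition resolvent_set ::
    "('a::real_normed_vector \<Rightarrow> real) \<Rightarrow> real \<Rightarrow> ('a \<Rightarrow> ('a \<Rightarrow>\<^sub>L real) set) \<Rightarrow> 'a \<Rightarrow> 'a set" where
  "resolvent_set g \<mu> B x = {z. grad g x \<in> (\<lambda>b. grad g z + \<mu> *\<^sub>R b) ` B z}"

definition resolvent ::
    "('a::real_normed_vector \<Rightarrow> real) \<Rightarrow> real \<Rightarrow> ('a \<Rightarrow> ('a \<Rightarrow>\<^sub>L real) set) \<Rightarrow> 'a \<Rightarrow> 'a" where
  "resolvent g \<mu> B x = the_elem (resolvent_set g \<mu> B x)"

end

theory Submission
  imports Defs
begin

text \<open>
  Strong convexity gives \<open>D(x, y) \<ge> (\<gamma>/2) \<parallel>x - y\<parallel>\<^sup>2\<close> for the Bregman distance \<open>D\<close> of \<open>g\<close>.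
  For a zero \<open>u\<close> of \<open>A + B\<close>, the three-point identity of \<open>D\<close> and strong monotonicity of the sum
  show that the nonnegative quantity
  \<open>D(u, v\<^sub>n) - \<mu> \<langle>A v\<^sub>n - A v\<^sub>n\<^sub>-\<^sub>1, v\<^sub>n - u\<rangle> + (\<mu>L/2) \<parallel>v\<^sub>n - v\<^sub>n\<^sub>-\<^sub>1\<parallel>\<^sup>2\<close>
  drops by at least \<open>\<mu>\<tau> \<parallel>v\<^sub>n\<^sub>+\<^sub>1 - u\<parallel>\<^sup>2\<close> in each step, hence \<open>v\<^sub>n \<rightarrow> u\<close>.

  This needs the resolvent to be everywhere defined, i.e. \<open>\<nabla>g + \<mu>B\<close> to be onto. After replacing \<open>g\<close>
  by \<open>(g - \<zeta>)/\<mu>\<close> one looks for a point of the graph of \<open>B\<close> that lies on the graph of \<open>-\<nabla>g\<close>.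
  The Fitzpatrick function of \<open>B\<close> dominates the pairing and \<open>(x, x\<^sup>*) \<mapsto> -g(x) - g\<^sup>*(-x\<^sup>*)\<close> is
  dominated by it, so the Hahn--Banach theorem puts an affine functional in between; by
  reflexivity its slope is a pair \<open>(p, p\<^sup>*)\<close>, which is the point sought.
\<close>

section \<open>A sandwich theorem of Hahn--Banach type\<close>

text \<open>Supplies the upper bounds for Zorn's lemma in
  \<open>convex_cone_linear_minorant\<close>. Only addition uses the chain condition: two summands
  lie together in the larger of their cones.\<close>

lemma convex_cone_Union_chain:
  assumes "C \<noteq> {}" and chain: "subset.chain {K. convex_cone K} C"
  shows "convex_cone (\<Union>C)"
proof -
  have cone: "convex_cone K" if "K \<in> C" for K
    using chain that by (auto simp: subset.chain_def)
  have "x + y \<in> \<Union>C" if "x \<in> K" "K \<in> C" "y \<in> J" "J \<in> C" for x y K J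
  proof -
    have "K \<subseteq> J \<or> J \<subseteq> K"
      using chain that by (metis subset_chain_def)
    then show ?thesis
      using that convex_cone_add[OF cone] by (metis UnionI subsetD)
  qed
  moreover have "0 \<in> \<Union>C"
    using assms(1) cone convex_cone_contains_0 by blast
  ultimately show ?thesis
    unfolding convex_cone_iff using convex_cone_scaleR[OF cone] by blast
qed

text \<open>The one-step extension of the Hahn-Banach argument: a maximal cone is tested by
  adjoining a single ray.\<close>

lemma convex_cone_add_ray:
  assumes "convex_cone M"
  shows "convex_cone {m + t *\<^sub>R p | m t. m \<in> M \<and> 0 \<le> t}"
  unfolding convex_cone_iff
proof (intro conjI ballI allI impI)
  show "0 \<in> {m + t *\<^sub>R p | m t. m \<in> M \<and> 0 \<le> t}"
    using convex_cone_contains_0[OF assms] by force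
next
  fix x y
  assume "x \<in> {m + t *\<^sub>R p | m t. m \<in> M \<and> 0 \<le> t}" "y \<in> {m + t *\<^sub>R p | m t. m \<in> M \<and> 0 \<le> t}"
  then obtain m t n s where mt: "x = m + t *\<^sub>R p" "m \<in> M" "0 \<le> t"
    and ns: "y = n + s *\<^sub>R p" "n \<in> M" "0 \<le> s"
    by blast
  have "x + y = (m + n) + (t + s) *\<^sub>R p"
    by (simp add: mt ns algebra_simps)
  moreover have "m + n \<in> M"
    using assms mt ns convex_cone_add by blast
  ultimately show "x + y \<in> {m + t *\<^sub>R p | m t. m \<in> M \<and> 0 \<le> t}"
    using mt ns add_nonneg_nonneg by blast
next
  fix x and c :: real
  assume "x \<in> {m + t *\<^sub>R p | m t. m \<in> M \<and> 0 \<le> t}" "0 \<le> c"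
  then obtain m t where mt: "x = m + t *\<^sub>R p" "m \<in> M" "0 \<le> t"
    by blast
  have "c *\<^sub>R x = c *\<^sub>R m + (c * t) *\<^sub>R p"
    by (simp add: mt algebra_simps)
  moreover have "c *\<^sub>R m \<in> M"
    using assms mt \<open>0 \<le> c\<close> convex_cone_scaleR by blast
  ultimately show "c *\<^sub>R x \<in> {m + t *\<^sub>R p | m t. m \<in> M \<and> 0 \<le> t}"
    using mt \<open>0 \<le> c\<close> mult_nonneg_nonneg by blast
qed

text \<open>A maximal convex cone that contains no
  \<open>(0, r)\<close> with \<open>r < 0\<close> is the epigraph of a linear functional.\<close>

lemma convex_cone_linear_minorant:
  fixes K :: "('v::real_vector \<times> real) set"
  assumes K: "convex_cone K" and K0: "\<And>r. (0, r) \<in> K \<Longrightarrow> 0 \<le> r" and onto: "fst ` K = UNIV"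
  obtains l :: "'v \<Rightarrow> real" where "linear l" and "\<And>w r. (w, r) \<in> K \<Longrightarrow> l w \<le> r"
proof -
  define P where "P M \<longleftrightarrow> convex_cone M \<and> K \<subseteq> M \<and> (\<forall>r. (0, r) \<in> M \<longrightarrow> 0 \<le> r)" for M
  have "\<exists>M\<in>Collect P. \<forall>X\<in>Collect P. M \<subseteq> X \<longrightarrow> X = M"
  proof (rule subset_Zorn_nonempty)
    show "Collect P \<noteq> {}"
      using K K0 P_def by blast
    show "\<Union>C \<in> Collect P" if "C \<noteq> {}" "subset.chain (Collect P) C" for C
    proof -
      have "subset.chain {K. convex_cone K} C"
        using that(2) by (auto simp: subset_chain_def P_def)
      then have "convex_cone (\<Union>C)"
        by (rule convex_cone_Union_chain[OF that(1)])
      moreover have "\<forall>M\<in>C. P M"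
        using that(2) by (auto simp: subset_chain_def)
      ultimately show ?thesis
        using that(1) unfolding P_def by blast
    qed
  qed
  then obtain M where M: "P M" and max: "\<And>X. P X \<Longrightarrow> M \<subseteq> X \<Longrightarrow> X = M"
    by blast
  have cone: "convex_cone M" and KM: "K \<subseteq> M" and M0: "\<And>r. (0, r) \<in> M \<Longrightarrow> 0 \<le> r"
    using M by (auto simp: P_def)
  \<comment> \<open>Maximality in usable form: adjoining the ray of \<open>(w, r)\<close> creates no
    negative point over 0 exactly when the right side holds.\<close>
  have mem_iff: "(w, r) \<in> M \<longleftrightarrow> (\<forall>s. (- w, s) \<in> M \<longrightarrow> 0 \<le> s + r)" for w r
  proof
    assume "(w, r) \<in> M"
    then show "\<forall>s. (- w, s) \<in> M \<longrightarrow> 0 \<le> s + r"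
      using convex_cone_add[OF cone, of "(- w, _)" "(w, r)"] M0 by auto
  next
    assume nonneg: "\<forall>s. (- w, s) \<in> M \<longrightarrow> 0 \<le> s + r"
    define X where "X = {m + t *\<^sub>R (w, r) | m t. m \<in> M \<and> 0 \<le> t}"
    have MX: "M \<subseteq> X"
      unfolding X_def by force
    have "0 \<le> q" if q: "(0, q) \<in> X" for q
    proof -
      obtain m t where mt: "(0, q) = m + t *\<^sub>R (w, r)" "m \<in> M" "0 \<le> t"
        using q unfolding X_def by blast
      \<comment> \<open>For \<open>t > 0\<close>, dividing by \<open>t\<close> moves
        \<open>m\<close> to a point over \<open>- w\<close>, where \<open>nonneg\<close>
        applies.\<close>
      have "m = (0, q) - t *\<^sub>R (w, r)"
        using mt(1) by (metis add_diff_cancel_right')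
      then have m: "m = (- (t *\<^sub>R w), q - t * r)"
        by simp
      show ?thesis
      proof (cases "t = 0")
        case True
        then show ?thesis
          using m mt(2) M0 by simp
      next
        case False
        have "(1 / t) *\<^sub>R m \<in> M"
          using convex_cone_scaleR[OF cone _ mt(2)] mt(3) by simp
        then have "(- w, (q - t * r) / t) \<in> M"
          using m False by simp
        then have "0 \<le> (q - t * r) / t + r"
          using nonneg by blast
        then show ?thesis
          using False mt(3) by (simp add: field_simps)
      qed
    qed
    then have "P X"
      unfolding P_def using convex_cone_add_ray[OF cone, of "(w, r)"] MX KM X_def by auto
    then have "X = M"
      using max MX by blast
    moreover have "0 + 1 *\<^sub>R (w, r) \<in> X"
      unfolding X_def using convex_cone_contains_0[OF cone] zero_le_one by blast
    ultimately show "(w, r) \<in> M"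
      by simp
  qed
  define l where "l w = Inf {r. (w, r) \<in> M}" for w
  have ne: "\<exists>r. (w, r) \<in> M" for w
  proof -
    have "w \<in> fst ` K"
      using onto by simp
    then show ?thesis
      using KM by force
  qed
  have l_le: "l w \<le> r" if "(w, r) \<in> M" for w r
  proof -
    obtain s where "(- w, s) \<in> M"
      using ne by blast
    then have "bdd_below {r. (w, r) \<in> M}"
      using mem_iff[of w] by (intro bdd_belowI[where m="- s"]) force
    then show ?thesis
      unfolding l_def using that by (intro cInf_lower) auto
  qed
  \<comment> \<open>The infimum is attained, since \<open>mem_iff\<close> describes the fibre of
    \<open>M\<close> over \<open>w\<close> by closed conditions \<open>- s \<le> r\<close>.\<close>
  have l_mem: "(w, l w) \<in> M" for w
    unfolding mem_iff[of w]
  proof (intro allI impI)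
    fix s
    assume "(- w, s) \<in> M"
    then have "- s \<le> l w"
      unfolding l_def using ne[of w] mem_iff[of w] by (intro cInf_greatest) force+
    then show "0 \<le> s + l w"
      by simp
  qed
  \<comment> \<open>Oddness upgrades subadditivity and positive homogeneity to linearity.\<close>
  have l_minus: "l (- w) = - l w" for w
  proof (rule antisym)
    have "(- w, - l w) \<in> M"
      using mem_iff[of "- w" "- l w"] l_le by simp
    then show "l (- w) \<le> - l w"
      by (rule l_le)
    have "(0, l w + l (- w)) \<in> M"
      using convex_cone_add[OF cone l_mem[of w] l_mem[of "- w"]] by simp
    then show "- l w \<le> l (- w)"
      using M0 by force
  qed
  have l_add_le: "l (v + w) \<le> l v + l w" for v w
    using convex_cone_add[OF cone l_mem[of v] l_mem[of w]] l_le by simp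
  have "l (v + w) = l v + l w" for v w
  proof (rule antisym[OF l_add_le])
    have "l (- v + - w) \<le> l (- v) + l (- w)"
      by (rule l_add_le)
    moreover have "- v + - w = - (v + w)"
      by simp
    ultimately show "l v + l w \<le> l (v + w)"
      by (metis l_minus minus_add_distrib neg_le_iff_le)
  qed
  moreover have "l (c *\<^sub>R w) = c *\<^sub>R l w" for c w
  proof -
    have pos: "l (c *\<^sub>R w) \<le> c * l w" if "0 \<le> c" for c w
      using convex_cone_scaleR[OF cone that l_mem[of w]] l_le by simp
    have pos': "l (c *\<^sub>R w) = c * l w" if "0 \<le> c" for c w
      using pos[OF that, of w] pos[OF that, of "- w"] by (simp add: l_minus)
    show ?thesis
    proof (cases "0 \<le> c")
      case True
      then show ?thesis
        using pos' by simp
    next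
      case False
      then show ?thesis
        using pos'[of "- c" w] by (simp add: l_minus)
    qed
  qed
  ultimately have "linear l"
    by (rule linearI)
  moreover have "l w \<le> r" if "(w, r) \<in> K" for w r
    using that KM l_le by blast
  ultimately show thesis
    using that by blast
qed

text \<open>Both sides are merged into one convex set \<open>P\<close>, the pairs
  \<open>(x - y, s + G y)\<close> and everything above them. By \<open>nonneg\<close> its fibre over
  0 is nonnegative, so its conic hull has a linear minorant. The bound on \<open>G\<close> near the
  single point \<open>x0\<close> makes this minorant continuous.\<close>

lemma convex_sandwich:
  fixes C :: "('v::real_normed_vector \<times> real) set" and G :: "'v \<Rightarrow> real"
  assumes C: "convex C" and C0: "(x0, s0) \<in> C" and G: "convex_on UNIV G"
    and nonneg: "\<And>x s. (x, s) \<in> C \<Longrightarrow> 0 \<le> s + G x"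
    and d: "d > 0" and bound: "\<And>y. norm (y - x0) < d \<Longrightarrow> G y \<le> M"
  shows "\<exists>l. bounded_linear l \<and> (\<forall>x s y. (x, s) \<in> C \<longrightarrow> l x - l y \<le> s + G y)"
proof -
  define P where "P = {(w, r). \<exists>x s. (x, s) \<in> C \<and> s + G (x - w) \<le> r}"
  have "convex P"
  proof (rule convexI)
    fix p q :: "'v \<times> real" and u v :: real
    assume "p \<in> P" "q \<in> P" and uv: "0 \<le> u" "0 \<le> v" "u + v = 1"
    then obtain x s y t where 1: "(x, s) \<in> C" "s + G (x - fst p) \<le> snd p"
      and 2: "(y, t) \<in> C" "t + G (y - fst q) \<le> snd q"
      unfolding P_def by auto
    have "u *\<^sub>R (x, s) + v *\<^sub>R (y, t) \<in> C"
      by (intro convexD[OF C] 1 2 uv)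
    then have mem: "(u *\<^sub>R x + v *\<^sub>R y, u * s + v * t) \<in> C"
      by simp
    have "G (u *\<^sub>R (x - fst p) + v *\<^sub>R (y - fst q)) \<le> u * G (x - fst p) + v * G (y - fst q)"
      using G uv unfolding convex_on_def by blast
    moreover have "u * (s + G (x - fst p)) \<le> u * snd p" "v * (t + G (y - fst q)) \<le> v * snd q"
      using 1 2 uv by (auto intro: mult_left_mono)
    ultimately have "u * s + v * t + G (u *\<^sub>R x + v *\<^sub>R y - (u *\<^sub>R fst p + v *\<^sub>R fst q))
        \<le> u * snd p + v * snd q"
      by (simp add: algebra_simps)
    with mem show "u *\<^sub>R p + v *\<^sub>R q \<in> P"
      unfolding P_def by (cases p, cases q) auto
  qed
  have P_nonneg: "0 \<le> r" if "(0, r) \<in> P" for r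
    using that nonneg unfolding P_def by force
  \<comment> \<open>As \<open>G\<close> is finite everywhere, the one point \<open>(x0, s0)\<close>
    of \<open>C\<close> puts points of \<open>P\<close> over every \<open>w\<close>.\<close>
  have P_all: "(w, s0 + G (x0 - w)) \<in> P" for w
    using C0 unfolding P_def by auto
  have cone: "convex_cone (conic hull P)"
    unfolding convex_cone_def
    using \<open>convex P\<close> P_all conic_conic_hull convex_conic_hull conic_hull_eq_empty by blast
  have cone0: "0 \<le> r" if r: "(0, r) \<in> conic hull P" for r
  proof -
    obtain c w s where "0 \<le> c" "(w, s) \<in> P" "0 = c *\<^sub>R w" "r = c * s"
      using r unfolding conic_hull_explicit by fastforce
    then show ?thesis
      using P_nonneg by (cases "c = 0") auto
  qed
  have onto: "fst ` (conic hull P) = UNIV"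
  proof -
    have "w \<in> fst ` (conic hull P)" for w
      using hull_inc[of _ P conic, OF P_all[of w]] by force
    then show ?thesis by auto
  qed
  obtain l :: "'v \<Rightarrow> real" where l: "linear l"
    and le: "\<And>w r. (w, r) \<in> conic hull P \<Longrightarrow> l w \<le> r"
    using convex_cone_linear_minorant[OF cone cone0 onto] by blast
  have le': "l x - l y \<le> s + G y" if "(x, s) \<in> C" for x s y
  proof -
    have "(x - y, s + G y) \<in> P"
      unfolding P_def using that by force
    then show ?thesis
      using le hull_inc linear_diff[OF l] by metis
  qed
  have near: "l w \<le> s0 + M" if "norm w < d" for w
  proof -
    have "l w \<le> s0 + G (x0 - w)"
      using le'[OF C0, of "x0 - w"] linear_diff[OF l] by simp
    also have "\<dots> \<le> s0 + M"
      using bound[of "x0 - w"] that by simp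
    finally show ?thesis .
  qed
  have "norm (l w) \<le> norm w * ((s0 + M) * 2 / d)" for w
  proof (cases "w = 0")
    case True
    then show ?thesis
      by (simp add: linear_0[OF l])
  next
    case False
    have half: "l w \<le> norm w * ((s0 + M) * 2 / d)" if "w \<noteq> 0" for w
    proof -
      \<comment> \<open>Scaling \<open>w\<close> to norm \<open>d / 2\<close> brings it into the
        ball where \<open>near\<close> applies.\<close>
      have "norm ((d / (2 * norm w)) *\<^sub>R w) < d"
        using that d by simp
      then have "(d / (2 * norm w)) * l w \<le> s0 + M"
        using near linear_scale[OF l] by (metis real_scaleR_def)
      then show ?thesis
        using that d by (simp add: field_simps)
    qed
    show ?thesis
      using half[OF False] half[of "- w"] False by (simp add: linear_neg[OF l] abs_le_iff)
  qed
  then have "bounded_linear l"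
    using l unfolding linear_conv_bounded_linear[symmetric]
    by (intro bounded_linear_intro[where K="(s0 + M) * 2 / d"]) (simp_all add: linear_add linear_scale)
  then show ?thesis
    using le' by blast
qed

section \<open>Maximal monotone operators\<close>

text \<open>The restriction of \<open>l\<close> to the second factor is an element of the bidual,
  which reflexivity turns into evaluation at a point \<open>p\<close>.\<close>

lemma reflexive_dual_prod:
  fixes l :: "'a::real_normed_vector \<times> ('a \<Rightarrow>\<^sub>L real) \<Rightarrow> real"
  assumes "reflexive_space TYPE('a)" and l: "bounded_linear l"
  shows "\<exists>p ps. \<forall>x xs. l (x, xs) = blinfun_apply ps x + blinfun_apply xs p"
proof -
  have "bounded_linear (\<lambda>x::'a. (x, 0::'a \<Rightarrow>\<^sub>L real))"
    and "bounded_linear (\<lambda>xs::'a \<Rightarrow>\<^sub>L real. (0::'a, xs))"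
    by (intro bounded_linear_Pair bounded_linear_ident bounded_linear_zero)+
  then have fst: "bounded_linear (\<lambda>x. l (x, 0))" and snd: "bounded_linear (\<lambda>xs. l (0, xs))"
    using bounded_linear_compose[OF l] by auto
  obtain p where p: "bidual_embedding p = Blinfun (\<lambda>xs. l (0, xs))"
    using assms(1) unfolding reflexive_space_def by (metis surj_def)
  have "l (x, xs) = blinfun_apply (Blinfun (\<lambda>x. l (x, 0))) x + blinfun_apply xs p" for x xs
  proof -
    have "l (x, xs) = l (x, 0) + l (0, xs)"
      using linear_add[OF bounded_linear.linear[OF l], of "(x, 0)" "(0, xs)"] by simp
    moreover have "l (0, xs) = blinfun_apply xs p"
      using bidual_embedding_apply[of p xs] by (simp add: p bounded_linear_Blinfun_apply snd)
    ultimately show ?thesis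
      by (simp add: bounded_linear_Blinfun_apply fst)
  qed
  then show ?thesis
    by blast
qed

text \<open>Adding \<open>(x, xs)\<close> to the graph keeps it monotone, so by maximality it was
  there already.\<close>

lemma maximal_monotone_mem:
  assumes B: "maximal_monotone B"
    and rel: "\<And>a as. as \<in> B a \<Longrightarrow> 0 \<le> blinfun_apply (xs - as) (x - a)"
  shows "xs \<in> B x"
proof (rule ccontr)
  assume "xs \<notin> B x"
  have swap: "blinfun_apply (as - xs) (a - x) = blinfun_apply (xs - as) (x - a)" for a as
    by (simp add: blinfun.diff_left blinfun.diff_right)
  have "monotone_operator (B(x := insert xs (B x)))"
    using B rel swap unfolding maximal_monotone_def monotone_operator_def
    by (auto split: if_splits)
  moreover have "operator_graph B \<subset> operator_graph (B(x := insert xs (B x)))"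
    using \<open>xs \<notin> B x\<close> unfolding operator_graph_def by (auto split: if_splits)
  ultimately show False
    using B unfolding maximal_monotone_def by blast
qed

text \<open>With an empty graph, the condition of \<open>maximal_monotone_mem\<close> would hold
  vacuously at every point.\<close>

lemma maximal_monotone_nonempty:
  assumes "maximal_monotone B"
  obtains a as where "as \<in> B a"
  using maximal_monotone_mem[OF assms] by blast

section \<open>Convex duality and the surjectivity argument\<close>

lemma convex_on_subgradients:
  fixes g :: "'a::real_normed_vector \<Rightarrow> real"
  assumes "\<And>x y. g y + blinfun_apply (h y) (x - y) \<le> g x"
  shows "convex_on UNIV g"
proof (rule convex_onI)
  fix t :: real and x y :: 'a
  assume t: "0 < t" "t < 1"
  define z where "z = (1 - t) *\<^sub>R x + t *\<^sub>R y"
  have "(1 - t) * (g z + blinfun_apply (h z) (x - z)) \<le> (1 - t) * g x"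
    "t * (g z + blinfun_apply (h z) (y - z)) \<le> t * g y"
    using t assms by (auto intro: mult_left_mono)
  moreover have "(1 - t) * blinfun_apply (h z) (x - z) + t * blinfun_apply (h z) (y - z) = 0"
    by (simp add: z_def blinfun.bilinear_simps algebra_simps)
  ultimately show "g z \<le> (1 - t) * g x + t * g y"
    by (simp add: algebra_simps)
qed auto

text \<open>Completing the square gives a bound that is uniform in \<open>x\<close>, hence a
  quadratic bound on the conjugate of \<open>g\<close>. It yields both finiteness and local
  boundedness of the conjugate.\<close>

lemma pairing_minus_le_quadratic:
  fixes g :: "'a::real_normed_vector \<Rightarrow> real"
  assumes c: "c > 0" and strong: "g 0 + blinfun_apply \<eta> x + c * (norm x)\<^sup>2 \<le> g x"
  shows "blinfun_apply \<xi> x - g x \<le> (norm (\<xi> - \<eta>))\<^sup>2 / (4 * c) - g 0"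
proof -
  let ?n = "norm (\<xi> - \<eta>)"
  have "0 \<le> (?n - 2 * c * norm x)\<^sup>2 / (4 * c)"
    using c by simp
  also have "\<dots> = ?n\<^sup>2 / (4 * c) + c * (norm x)\<^sup>2 - ?n * norm x"
    using c by (simp add: power2_eq_square field_simps)
  finally have "?n * norm x \<le> ?n\<^sup>2 / (4 * c) + c * (norm x)\<^sup>2"
    by simp
  moreover have "blinfun_apply (\<xi> - \<eta>) x \<le> ?n * norm x"
    using norm_blinfun[of "\<xi> - \<eta>" x] by simp
  ultimately show ?thesis
    using strong by (simp add: blinfun.diff_left)
qed

text \<open>The point \<open>(p, ps)\<close> of the graph is read off an affine functional that separates the
  Fitzpatrick function of \<open>B\<close>, whose epigraph is \<open>C\<close>, from \<open>(y, ys) \<mapsto> - g y - g\<^sup>* (- ys)\<close>.\<close>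

lemma maximal_monotone_meets_neg_gradient:
  fixes g :: "'a::real_normed_vector \<Rightarrow> real" and h :: "'a \<Rightarrow> ('a \<Rightarrow>\<^sub>L real)"
  assumes refl: "reflexive_space TYPE('a)" and B: "maximal_monotone B" and c: "c > 0"
    and strong: "\<And>x y. g y + blinfun_apply (h y) (x - y) + c * (norm (x - y))\<^sup>2 \<le> g x"
    and h: "surj h"
    and bounded: "\<And>x. \<exists>d>0. \<exists>M. \<forall>y. norm (y - x) < d \<longrightarrow> g y \<le> M"
  obtains p where "- h p \<in> B p"
proof -
  define T where "T = inv h"
  have hT: "h (T \<xi>) = \<xi>" for \<xi>
    unfolding T_def using h by (rule surj_f_inv_f)
  \<comment> \<open>This is the conjugate of \<open>g\<close>: the supremum is attained at
    \<open>T \<xi>\<close>, where the gradient equals \<open>\<xi>\<close>.\<close>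
  define gs where "gs \<xi> = blinfun_apply \<xi> (T \<xi>) - g (T \<xi>)" for \<xi>
  have sub: "g y + blinfun_apply (h y) (x - y) \<le> g x" for x y
    using strong[of y x] c by (smt (verit) zero_le_mult_iff zero_le_power2)
  have FY: "blinfun_apply \<xi> x - g x \<le> gs \<xi>" for \<xi> x
    using sub[of "T \<xi>" x] by (simp add: gs_def hT blinfun.diff_right)
  have gs_h: "gs (h p) \<le> blinfun_apply (h p) p - g p" for p
    using sub[of p "T (h p)"] by (simp add: gs_def hT blinfun.diff_right)
  have gs_bound: "gs \<xi> \<le> (norm (\<xi> - h 0))\<^sup>2 / (4 * c) - g 0" for \<xi>
    unfolding gs_def using strong[of 0] c by (intro pairing_minus_le_quadratic) simp_all
  have gs_convex: "gs ((1 - t) *\<^sub>R \<xi> + t *\<^sub>R \<eta>) \<le> (1 - t) * gs \<xi> + t * gs \<eta>"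
    if "0 < t" "t < 1" for t \<xi> \<eta>
  proof -
    let ?y = "T ((1 - t) *\<^sub>R \<xi> + t *\<^sub>R \<eta>)"
    have "(1 - t) * (blinfun_apply \<xi> ?y - g ?y) \<le> (1 - t) * gs \<xi>"
      "t * (blinfun_apply \<eta> ?y - g ?y) \<le> t * gs \<eta>"
      using that FY by (auto intro: mult_left_mono)
    then show ?thesis
      unfolding gs_def[of "(1 - t) *\<^sub>R \<xi> + t *\<^sub>R \<eta>"]
      by (simp add: blinfun.bilinear_simps algebra_simps)
  qed
  define G where "G q = g (fst q) + gs (- snd q)" for q
  have G: "convex_on UNIV G"
  proof (rule convex_onI)
    fix t :: real and q r :: "'a \<times> ('a \<Rightarrow>\<^sub>L real)"
    assume t: "0 < t" "t < 1"
    have "g ((1 - t) *\<^sub>R fst q + t *\<^sub>R fst r) \<le> (1 - t) * g (fst q) + t * g (fst r)"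
      using convex_onD[OF convex_on_subgradients[of g h, OF sub], of t "fst q" "fst r"] t by simp
    moreover have "gs (- ((1 - t) *\<^sub>R snd q + t *\<^sub>R snd r))
        \<le> (1 - t) * gs (- snd q) + t * gs (- snd r)"
      using gs_convex[OF t, of "- snd q" "- snd r"] by (simp add: algebra_simps)
    ultimately show "G ((1 - t) *\<^sub>R q + t *\<^sub>R r) \<le> (1 - t) * G q + t * G r"
      by (simp add: G_def algebra_simps)
  qed auto
  define C where "C = {((x, xs), s). \<forall>a. \<forall>as\<in>B a.
      blinfun_apply as x + blinfun_apply xs a - blinfun_apply as a \<le> s}"
  have "convex C"
  proof (rule convexI)
    fix q r :: "('a \<times> ('a \<Rightarrow>\<^sub>L real)) \<times> real" and u v :: real
    assume q: "q \<in> C" and r: "r \<in> C" and uv: "0 \<le> u" "0 \<le> v" "u + v = 1"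
    obtain x xs s where q_eq: "q = ((x, xs), s)"
      by (metis prod.exhaust)
    obtain y ys t where r_eq: "r = ((y, ys), t)"
      by (metis prod.exhaust)
    have "blinfun_apply as (u *\<^sub>R x + v *\<^sub>R y) + blinfun_apply (u *\<^sub>R xs + v *\<^sub>R ys) a
        - blinfun_apply as a \<le> u * s + v * t" if "as \<in> B a" for a as
    proof -
      have "u * (blinfun_apply as x + blinfun_apply xs a - blinfun_apply as a) \<le> u * s"
        "v * (blinfun_apply as y + blinfun_apply ys a - blinfun_apply as a) \<le> v * t"
        using q r uv that unfolding C_def q_eq r_eq by (auto intro!: mult_left_mono)
      moreover have "blinfun_apply as a = u * blinfun_apply as a + v * blinfun_apply as a"
        using uv by (metis distrib_right mult_1)
      ultimately show ?thesis
        by (simp add: blinfun.bilinear_simps algebra_simps)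
    qed
    then show "u *\<^sub>R q + v *\<^sub>R r \<in> C"
      unfolding q_eq r_eq C_def by simp
  qed
  \<comment> \<open>On the graph the Fitzpatrick function is at most the pairing, by
    monotonicity.\<close>
  have graph_C: "((a, as), blinfun_apply as a) \<in> C" if "as \<in> B a" for a as
  proof -
    have "0 \<le> blinfun_apply (as - bs) (a - b)" if "bs \<in> B b" for b bs
      using B \<open>as \<in> B a\<close> that unfolding maximal_monotone_def monotone_operator_def by blast
    then show ?thesis
      unfolding C_def by (force simp: blinfun.bilinear_simps)
  qed
  \<comment> \<open>If \<open>s\<close> were below the pairing, \<open>(x, xs)\<close> would be
    monotonically related to the whole graph and so belong to it; testing the defining inequality of
    \<open>C\<close> at \<open>(x, xs)\<close> itself then gives a contradiction.\<close>
  have C_ge: "blinfun_apply xs x \<le> s" if "((x, xs), s) \<in> C" for x xs s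
  proof (rule ccontr)
    assume less: "\<not> blinfun_apply xs x \<le> s"
    have C: "blinfun_apply as x + blinfun_apply xs a - blinfun_apply as a \<le> s"
      if "as \<in> B a" for a as
      using \<open>((x, xs), s) \<in> C\<close> that unfolding C_def by blast
    have "xs \<in> B x"
      using C less by (intro maximal_monotone_mem[OF B]) (force simp: blinfun.bilinear_simps)
    then show False
      using C less by fastforce
  qed
  have C_nonneg: "0 \<le> s + G q" if "(q, s) \<in> C" for q s
    using C_ge[of "fst q" "snd q" s] FY[of "- snd q" "fst q"] that
    by (simp add: G_def blinfun.minus_left)
  obtain a0 as0 where a0: "as0 \<in> B a0"
    using maximal_monotone_nonempty[OF B] .
  obtain d M where d: "d > 0" and M: "\<And>y. norm (y - a0) < d \<Longrightarrow> g y \<le> M"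
    using bounded by blast
  have G_bound: "G q \<le> M + ((d + norm as0 + norm (h 0))\<^sup>2 / (4 * c) - g 0)"
    if "norm (q - (a0, as0)) < d" for q
  proof -
    have "q - (a0, as0) = (fst q - a0, snd q - as0)"
      by (simp add: prod_eq_iff)
    then have "norm (fst q - a0) < d" "norm (snd q - as0) < d"
      using norm_fst_le[of "fst q - a0" "snd q - as0"] norm_snd_le[of "snd q - as0" "fst q - a0"] that
      by simp_all
    moreover have "norm (- snd q - h 0) \<le> norm (snd q - as0) + norm as0 + norm (h 0)"
      by (smt (verit) norm_minus_cancel norm_triangle_ineq4 norm_triangle_sub)
    ultimately have "norm (- snd q - h 0) \<le> d + norm as0 + norm (h 0)" "g (fst q) \<le> M"
      using M by auto
    then have "(norm (- snd q - h 0))\<^sup>2 / (4 * c) \<le> (d + norm as0 + norm (h 0))\<^sup>2 / (4 * c)"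
      using c by (intro divide_right_mono power_mono) auto
    then show ?thesis
      using gs_bound[of "- snd q"] \<open>g (fst q) \<le> M\<close> unfolding G_def by linarith
  qed
  obtain l where l: "bounded_linear l" and sep: "\<And>q s r. (q, s) \<in> C \<Longrightarrow> l q - l r \<le> s + G r"
    using convex_sandwich[OF \<open>convex C\<close> graph_C[OF a0] G C_nonneg d G_bound] by auto
  obtain p ps where l_eq: "\<And>x xs. l (x, xs) = blinfun_apply ps x + blinfun_apply xs p"
    using reflexive_dual_prod[OF refl l] by auto
  define y where "y = T (- ps)"
  have hy: "h y = - ps"
    by (simp add: y_def hT)
  \<comment> \<open>Separating at \<open>(y, - h p)\<close> cancels the pairing of
    \<open>h p\<close> with \<open>p\<close> and leaves the convexity gap of \<open>g\<close>
    between \<open>p\<close> and \<open>y\<close>, because \<open>ps = - h y\<close>.\<close>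
  have key: "c * (norm (p - y))\<^sup>2 \<le> blinfun_apply (ps - as) (p - a)" if "as \<in> B a" for a as
    using sep[OF graph_C[OF that], of "(y, - h p)"] gs_h[of p] strong[of y p]
    by (simp add: l_eq G_def hy blinfun.bilinear_simps)
  \<comment> \<open>The left side of \<open>key\<close> is nonnegative, so maximality puts
    \<open>(p, ps)\<close> on the graph; at this very point the right side of \<open>key\<close> is
    0, which forces \<open>p = y\<close>.\<close>
  have "ps \<in> B p"
    using key c by (intro maximal_monotone_mem[OF B]) (smt (verit) zero_le_mult_iff zero_le_power2)
  with key[OF this] c have "p = y"
    by (simp add: mult_le_0_iff)
  then have "- h p = ps"
    using hy by simp
  with \<open>ps \<in> B p\<close> show thesis
    using that[of p] by simp
qed

section \<open>Gradients and conjugates\<close>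

lemma has_gateaux_derivative_real_iff:
  fixes f :: "'b::real_normed_vector \<Rightarrow> real"
  shows "has_gateaux_derivative (\<lambda>x. ereal (f x)) D x \<longleftrightarrow>
    (\<forall>y. ((\<lambda>t. (f (x + t *\<^sub>R y) - f x) / t) \<longlongrightarrow> blinfun_apply D y) (at 0))"
proof -
  have "((\<lambda>t. (ereal (f (x + t *\<^sub>R y)) - ereal (f x)) / ereal t) \<longlongrightarrow> ereal (blinfun_apply D y)) (at 0)
    \<longleftrightarrow> ((\<lambda>t. ereal ((f (x + t *\<^sub>R y) - f x) / t)) \<longlongrightarrow> ereal (blinfun_apply D y)) (at 0)" for y
    by (rule tendsto_cong) (auto simp: eventually_at_filter)
  then show ?thesis
    by (simp add: has_gateaux_derivative_def)
qed

lemma has_gateaux_derivative_unique: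
  assumes "has_gateaux_derivative f D x" "has_gateaux_derivative f E x"
  shows "D = E"
proof (rule blinfun_eqI)
  fix y
  have "((\<lambda>t::real. (f (x + t *\<^sub>R y) - f x) / ereal t) \<longlongrightarrow> ereal (blinfun_apply D y)) (at 0)"
    and "((\<lambda>t::real. (f (x + t *\<^sub>R y) - f x) / ereal t) \<longlongrightarrow> ereal (blinfun_apply E y)) (at 0)"
    using assms unfolding has_gateaux_derivative_def by blast+
  then have "ereal (blinfun_apply D y) = ereal (blinfun_apply E y)"
    by (rule tendsto_unique[OF trivial_limit_at])
  then show "blinfun_apply D y = blinfun_apply E y"
    by simp
qed

lemma has_gateaux_derivative_gradient:
  assumes "gateaux_differentiable_at f x"
  shows "has_gateaux_derivative f (gradient f x) x"
proof -
  obtain D where D: "has_gateaux_derivative f D x"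
    using assms unfolding gateaux_differentiable_at_def by blast
  then have "gradient f x = D"
    unfolding gradient_def using has_gateaux_derivative_unique by (intro the_equality)
  with D show ?thesis
    by simp
qed

text \<open>Convexity bounds the difference quotients for \<open>0 < t < 1\<close> by
  \<open>f y - f x\<close>, and the bound survives the right-hand limit.\<close>

lemma gateaux_derivative_subgradient:
  fixes f :: "'b::real_normed_vector \<Rightarrow> real"
  assumes f: "convex_on UNIV f" and D: "has_gateaux_derivative (\<lambda>x. ereal (f x)) D x"
  shows "f x + blinfun_apply D (y - x) \<le> f y"
proof -
  have "((\<lambda>t. (f (x + t *\<^sub>R (y - x)) - f x) / t) \<longlongrightarrow> blinfun_apply D (y - x)) (at_right 0)"
    using D unfolding has_gateaux_derivative_real_iff by (blast intro: tendsto_within_subset)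
  moreover have "\<forall>\<^sub>F t in at_right 0. (f (x + t *\<^sub>R (y - x)) - f x) / t \<le> f y - f x"
    unfolding eventually_at_right_field
  proof (intro exI[of _ 1] conjI allI impI)
    fix t :: real
    assume t: "0 < t" "t < 1"
    have "x + t *\<^sub>R (y - x) = (1 - t) *\<^sub>R x + t *\<^sub>R y"
      by (simp add: algebra_simps)
    then have "f (x + t *\<^sub>R (y - x)) \<le> (1 - t) * f x + t * f y"
      using convex_onD[OF f, of t x y] t by simp
    then show "(f (x + t *\<^sub>R (y - x)) - f x) / t \<le> f y - f x"
      using t by (simp add: field_simps)
  qed simp
  ultimately have "blinfun_apply D (y - x) \<le> f y - f x"
    by (rule tendsto_upperbound) simp
  then show ?thesis
    by simp
qed

text \<open>Right-hand quotients dominate \<open>\<xi>\<close> in every direction; using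
  \<open>y\<close> and \<open>- y\<close> turns this into equality.\<close>

lemma subgradient_eq_gateaux_derivative:
  fixes f :: "'b::real_normed_vector \<Rightarrow> real"
  assumes D: "has_gateaux_derivative (\<lambda>x. ereal (f x)) D x"
    and sub: "\<And>y. f x + blinfun_apply \<xi> (y - x) \<le> f y"
  shows "D = \<xi>"
proof (rule blinfun_eqI)
  have le: "blinfun_apply \<xi> y \<le> blinfun_apply D y" for y
  proof -
    have "((\<lambda>t. (f (x + t *\<^sub>R y) - f x) / t) \<longlongrightarrow> blinfun_apply D y) (at_right 0)"
      using D unfolding has_gateaux_derivative_real_iff by (blast intro: tendsto_within_subset)
    moreover have "\<forall>\<^sub>F t in at_right 0. blinfun_apply \<xi> y \<le> (f (x + t *\<^sub>R y) - f x) / t"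
      unfolding eventually_at_right_field
    proof (intro exI[of _ 1] conjI allI impI)
      fix t :: real
      assume t: "0 < t" "t < 1"
      have "f x + t * blinfun_apply \<xi> y \<le> f (x + t *\<^sub>R y)"
        using sub[of "x + t *\<^sub>R y"] by (simp add: blinfun.scaleR_right)
      then show "blinfun_apply \<xi> y \<le> (f (x + t *\<^sub>R y) - f x) / t"
        using t by (simp add: field_simps)
    qed simp
    ultimately show ?thesis
      by (rule tendsto_lowerbound) simp
  qed
  show "blinfun_apply D y = blinfun_apply \<xi> y" for y
    using le[of y] le[of "- y"] by (simp add: blinfun.minus_right)
qed

text \<open>Since \<open>strongly_convex\<close> is strong monotonicity of the gradient, the
  quadratic gap comes from integrating along the segment: \<open>\<phi>\<close> is nondecreasing on
  \<open>[0, 1]\<close>.\<close>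

lemma strongly_convex_gap:
  fixes g :: "'a::real_normed_vector \<Rightarrow> real"
  assumes diff: "\<And>x. gateaux_differentiable_at (\<lambda>x. ereal (g x)) x" and g: "strongly_convex \<gamma> g"
  shows "g y + blinfun_apply (grad g y) (x - y) + \<gamma> / 2 * (norm (x - y))\<^sup>2 \<le> g x"
proof -
  define k where "k = x - y"
  define \<phi> where "\<phi> t = g (y + t *\<^sub>R k) - t * blinfun_apply (grad g y) k - \<gamma> / 2 * t\<^sup>2 * (norm k)\<^sup>2" for t
  have "\<exists>D. DERIV \<phi> t :> D \<and> 0 \<le> D" if "0 \<le> t" for t
  proof (intro exI conjI)
    have "((\<lambda>s. (g (y + t *\<^sub>R k + s *\<^sub>R k) - g (y + t *\<^sub>R k)) / s)
        \<longlongrightarrow> blinfun_apply (grad g (y + t *\<^sub>R k)) k) (at 0)"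
      using has_gateaux_derivative_gradient[OF diff, of "y + t *\<^sub>R k"]
      unfolding has_gateaux_derivative_real_iff by blast
    then have "DERIV (\<lambda>t. g (y + t *\<^sub>R k)) t :> blinfun_apply (grad g (y + t *\<^sub>R k)) k"
      unfolding DERIV_def by (simp add: scaleR_left_distrib add.assoc)
    then show "DERIV \<phi> t :> blinfun_apply (grad g (y + t *\<^sub>R k)) k - blinfun_apply (grad g y) k
        - \<gamma> * t * (norm k)\<^sup>2"
      unfolding \<phi>_def by (auto intro!: derivative_eq_intros)
    \<comment> \<open>Monotonicity is tested on \<open>t *\<^sub>R k\<close>, so a factor
      \<open>t\<close> has to be divided out; at \<open>t = 0\<close> the two gradients
      coincide.\<close>
    have mono: "\<gamma> * (norm (t *\<^sub>R k))\<^sup>2 \<le> blinfun_apply (grad g (y + t *\<^sub>R k) - grad g y) (t *\<^sub>R k)"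
      using g unfolding strongly_convex_def by (metis add_diff_cancel_left')
    show "0 \<le> blinfun_apply (grad g (y + t *\<^sub>R k)) k - blinfun_apply (grad g y) k
        - \<gamma> * t * (norm k)\<^sup>2"
    proof (cases "t = 0")
      case False
      have "0 \<le> t * (blinfun_apply (grad g (y + t *\<^sub>R k)) k - blinfun_apply (grad g y) k
          - \<gamma> * t * (norm k)\<^sup>2)"
        using mono by (simp add: blinfun.bilinear_simps power_mult_distrib power2_eq_square algebra_simps)
      then show ?thesis
        using False that by (simp add: zero_le_mult_iff)
    qed simp
  qed
  then have "\<phi> 0 \<le> \<phi> 1"
    using DERIV_nonneg_imp_nondecreasing[of 0 1 \<phi>] by simp
  then show ?thesis
    by (simp add: \<phi>_def k_def)
qed

text \<open>Uniformity in the direction gives one radius \<open>d\<close> for all unit vectors. The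
  bound feeds the continuity part of \<open>convex_sandwich\<close>.\<close>

lemma uniformly_frechet_locally_bounded:
  fixes g :: "'a::real_normed_vector \<Rightarrow> real"
  assumes "uniformly_frechet_differentiable g"
  shows "\<exists>d>0. \<exists>M. \<forall>y. norm (y - x) < d \<longrightarrow> g y \<le> M"
proof -
  have "\<forall>\<^sub>F t in at 0. \<forall>q\<in>UNIV \<times> sphere 0 1. dist (case q of (x, y) \<Rightarrow> (g (x + t *\<^sub>R y) - g x) / t)
      (case q of (x, y) \<Rightarrow> blinfun_apply (grad g x) y) < 1"
    using assms unfolding uniformly_frechet_differentiable_def by (auto dest!: uniform_limitD[where e=1])
  then obtain d where d: "d > 0"
    and close: "\<And>t q. t \<noteq> 0 \<Longrightarrow> \<bar>t\<bar> < d \<Longrightarrow> q \<in> UNIV \<times> sphere 0 1 \<Longrightarrow>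
      dist (case q of (x, y) \<Rightarrow> (g (x + t *\<^sub>R y) - g x) / t)
        (case q of (x, y) \<Rightarrow> blinfun_apply (grad g x) y) < 1"
    unfolding eventually_at by (auto simp: dist_real_def)
  have "g y \<le> g x + d * (norm (grad g x) + 1)" if y: "norm (y - x) < d" for y
  proof (cases "y = x")
    case True
    then show ?thesis
      using d by simp
  next
    case False
    define t where "t = norm (y - x)"
    define e where "e = (1 / t) *\<^sub>R (y - x)"
    have t: "0 < t" "t < d" and e: "norm e = 1" and y_eq: "x + t *\<^sub>R e = y"
      using False y by (auto simp: t_def e_def)
    have "(g y - g x) / t \<le> blinfun_apply (grad g x) e + 1"
      using close[of t "(x, e)"] t e by (simp add: y_eq dist_real_def)
    also have "\<dots> \<le> norm (grad g x) + 1"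
      using norm_blinfun[of "grad g x" e] e by simp
    finally have "g y \<le> g x + t * (norm (grad g x) + 1)"
      using t by (simp add: field_simps)
    also have "\<dots> \<le> g x + d * (norm (grad g x) + 1)"
      using t by (intro add_left_mono mult_right_mono) auto
    finally show ?thesis .
  qed
  then show ?thesis
    using d by blast
qed

text \<open>The point \<open>x = grad_conj g \<xi>\<close> is a subgradient of the conjugate at
  \<open>\<xi>\<close>. This yields equality in the Fenchel-Young inequality, so
  \<open>\<xi>\<close> is a subgradient of \<open>g\<close> at \<open>x\<close> and hence its
  gradient.\<close>

lemma grad_grad_conj:
  fixes g :: "'a::real_normed_vector \<Rightarrow> real"
  assumes refl: "reflexive_space TYPE('a)"
    and diff: "\<And>x. gateaux_differentiable_at (\<lambda>x. ereal (g x)) x"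
    and leg: "legendre (\<lambda>x. ereal (g x))" and c: "c > 0"
    and strong: "\<And>x y. g y + blinfun_apply (grad g y) (x - y) + c * (norm (x - y))\<^sup>2 \<le> g x"
  shows "grad g (grad_conj g \<xi>) = \<xi>"
proof -
  define conj where "conj \<xi> = (SUP x. blinfun_apply \<xi> x - g x)" for \<xi> :: "'a \<Rightarrow>\<^sub>L real"
  have bdd: "bdd_above (range (\<lambda>x. blinfun_apply \<xi> x - g x))" for \<xi>
  proof (rule bdd_aboveI2)
    fix x
    show "blinfun_apply \<xi> x - g x \<le> (norm (\<xi> - grad g 0))\<^sup>2 / (4 * c) - g 0"
      using strong[of 0 x] c by (intro pairing_minus_le_quadratic) simp_all
  qed
  have FY: "blinfun_apply \<xi> x - g x \<le> conj \<xi>" for \<xi> x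
    unfolding conj_def using bdd by (rule cSUP_upper2) auto
  have conj_le: "conj \<xi> \<le> b" if "\<And>x. blinfun_apply \<xi> x - g x \<le> b" for \<xi> b
    unfolding conj_def using that by (intro cSUP_least) auto
  have fenchel: "fenchel_conjugate (\<lambda>x. ereal (g x)) = (\<lambda>\<xi>. ereal (conj \<xi>))"
  proof
    fix \<xi>
    have "fenchel_conjugate (\<lambda>x. ereal (g x)) \<xi> = (SUP x. ereal (blinfun_apply \<xi> x - g x))"
      by (simp add: fenchel_conjugate_def)
    also have "\<dots> = ereal (conj \<xi>)"
    proof (rule SUP_eqI)
      show "ereal (conj \<xi>) \<le> y" if "\<And>x. x \<in> UNIV \<Longrightarrow> ereal (blinfun_apply \<xi> x - g x) \<le> y" for y
        using that conj_le[of \<xi>] by (cases y) auto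
    qed (use FY in auto)
    finally show "fenchel_conjugate (\<lambda>x. ereal (g x)) \<xi> = ereal (conj \<xi>)" .
  qed
  have conj_convex: "convex_on UNIV conj"
  proof (rule convex_onI)
    fix t :: real and \<xi> \<eta> :: "'a \<Rightarrow>\<^sub>L real"
    assume t: "0 < t" "t < 1"
    show "conj ((1 - t) *\<^sub>R \<xi> + t *\<^sub>R \<eta>) \<le> (1 - t) * conj \<xi> + t * conj \<eta>"
    proof (rule conj_le)
      fix x
      have "(1 - t) * (blinfun_apply \<xi> x - g x) \<le> (1 - t) * conj \<xi>"
        "t * (blinfun_apply \<eta> x - g x) \<le> t * conj \<eta>"
        using t FY by (auto intro: mult_left_mono)
      then show "blinfun_apply ((1 - t) *\<^sub>R \<xi> + t *\<^sub>R \<eta>) x - g x \<le> (1 - t) * conj \<xi> + t * conj \<eta>"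
        by (simp add: blinfun.bilinear_simps algebra_simps)
    qed
  qed auto
  \<comment> \<open>The conjugate is finite everywhere, so the interior of its domain is the whole
    dual.\<close>
  have "gateaux_differentiable_at (\<lambda>\<xi>. ereal (conj \<xi>)) \<xi>"
    using leg unfolding legendre_def fenchel by (simp add: effective_domain_def)
  then have D: "has_gateaux_derivative (\<lambda>\<xi>. ereal (conj \<xi>)) (gradient (\<lambda>\<xi>. ereal (conj \<xi>)) \<xi>) \<xi>"
    by (rule has_gateaux_derivative_gradient)
  define x where "x = grad_conj g \<xi>"
  have "gradient (\<lambda>\<xi>. ereal (conj \<xi>)) \<xi> = bidual_embedding x"
    using refl unfolding x_def grad_conj_def fenchel reflexive_space_def by (simp add: surj_f_inv_f)
  then have sub: "conj \<xi> + blinfun_apply (\<eta> - \<xi>) x \<le> conj \<eta>" for \<eta>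
    using gateaux_derivative_subgradient[OF conj_convex D, of \<eta>] by simp
  have "conj (grad g x) \<le> blinfun_apply (grad g x) x - g x"
  proof (rule conj_le)
    fix y
    show "blinfun_apply (grad g x) y - g y \<le> blinfun_apply (grad g x) x - g x"
      using strong[of x y] c by (smt (verit) blinfun.diff_right zero_le_mult_iff zero_le_power2)
  qed
  then have eq: "conj \<xi> \<le> blinfun_apply \<xi> x - g x"
    using sub[of "grad g x"] by (simp add: blinfun.diff_left)
  have "g x + blinfun_apply \<xi> (y - x) \<le> g y" for y
    using eq FY[of \<xi> y] by (simp add: blinfun.diff_right)
  then show ?thesis
    unfolding x_def[symmetric]
    using subgradient_eq_gateaux_derivative[OF has_gateaux_derivative_gradient[OF diff]] by blast
qed

section \<open>The resolvent and the Lyapunov function\<close>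

lemma resolvent_set_nonempty:
  fixes g :: "'a::real_normed_vector \<Rightarrow> real"
  assumes refl: "reflexive_space TYPE('a)" and B: "maximal_monotone B"
    and "c > 0" "\<mu> > 0"
    and strong: "\<And>x y. g y + blinfun_apply (grad g y) (x - y) + c * (norm (x - y))\<^sup>2 \<le> g x"
    and onto: "surj (grad g)"
    and bounded: "\<And>x. \<exists>d>0. \<exists>M. \<forall>y. norm (y - x) < d \<longrightarrow> g y \<le> M"
  shows "resolvent_set g \<mu> B x \<noteq> {}"
proof -
  \<comment> \<open>A point \<open>p\<close> lies in the resolvent set iff \<open>- h' p\<close> is
    in \<open>B p\<close>, where \<open>h'\<close> is the gradient of \<open>g'\<close>; the
    convexity constant becomes \<open>c / \<mu>\<close>.\<close>
  define \<zeta> where "\<zeta> = grad g x"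
  define g' where "g' y = (g y - blinfun_apply \<zeta> y) / \<mu>" for y
  define h' where "h' y = (1 / \<mu>) *\<^sub>R (grad g y - \<zeta>)" for y
  have "c / \<mu> > 0"
    using assms by simp
  moreover have "g' y + blinfun_apply (h' y) (x - y) + c / \<mu> * (norm (x - y))\<^sup>2 \<le> g' x" for x y
  proof -
    have "g' y + blinfun_apply (h' y) (x - y) + c / \<mu> * (norm (x - y))\<^sup>2
      = (g y - blinfun_apply \<zeta> y + blinfun_apply (grad g y - \<zeta>) (x - y) + c * (norm (x - y))\<^sup>2) / \<mu>"
      by (simp add: g'_def h'_def blinfun.scaleR_left add_divide_distrib)
    also have "\<dots> \<le> g' x"
      unfolding g'_def using strong[of y x] \<open>\<mu> > 0\<close>
      by (intro divide_right_mono) (simp_all add: blinfun.bilinear_simps)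
    finally show ?thesis .
  qed
  moreover have "surj h'"
  proof (rule surjI)
    show "h' (inv (grad g) (\<mu> *\<^sub>R \<xi> + \<zeta>)) = \<xi>" for \<xi>
      using \<open>\<mu> > 0\<close> by (simp add: h'_def surj_f_inv_f[OF onto])
  qed
  moreover have "\<exists>d>0. \<exists>M. \<forall>y. norm (y - x) < d \<longrightarrow> g' y \<le> M" for x
  proof -
    obtain d M where d: "d > 0" and M: "\<And>y. norm (y - x) < d \<Longrightarrow> g y \<le> M"
      using bounded by blast
    have "g' y \<le> (M + norm \<zeta> * (d + norm x)) / \<mu>" if "norm (y - x) < d" for y
    proof -
      have "norm y \<le> d + norm x"
        using that norm_triangle_sub[of y x] by simp
      then have "norm \<zeta> * norm y \<le> norm \<zeta> * (d + norm x)"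
        by (simp add: mult_left_mono)
      moreover have "- blinfun_apply \<zeta> y \<le> norm \<zeta> * norm y"
        using norm_blinfun[of \<zeta> y] by simp
      ultimately show ?thesis
        unfolding g'_def using M[OF that] \<open>\<mu> > 0\<close> by (intro divide_right_mono) auto
    qed
    then show ?thesis
      using d by blast
  qed
  ultimately obtain p where "- h' p \<in> B p"
    by (rule maximal_monotone_meets_neg_gradient[OF refl B])
  moreover have "grad g x = grad g p + \<mu> *\<^sub>R (- h' p)"
    using \<open>\<mu> > 0\<close> by (simp add: h'_def \<zeta>_def)
  ultimately show ?thesis
    unfolding resolvent_set_def by blast
qed

text \<open>Two solutions have gradients differing by \<open>- \<mu>\<close> times a difference of
  values of \<open>B\<close>, so monotonicity of \<open>B\<close> opposes strong convexity.\<close>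

lemma resolvent_set_unique:
  assumes B: "monotone_operator B" and g: "strongly_convex \<gamma> g" and "\<gamma> > 0" "\<mu> > 0"
    and y: "y \<in> resolvent_set g \<mu> B x" and z: "z \<in> resolvent_set g \<mu> B x"
  shows "y = z"
proof -
  obtain b where b: "b \<in> B y" "grad g x = grad g y + \<mu> *\<^sub>R b"
    using y unfolding resolvent_set_def by blast
  obtain c where c: "c \<in> B z" "grad g x = grad g z + \<mu> *\<^sub>R c"
    using z unfolding resolvent_set_def by blast
  have "grad g y - grad g z = - (\<mu> *\<^sub>R (b - c))"
    using b(2) c(2) by (simp add: algebra_simps)
  then have "\<gamma> * (norm (y - z))\<^sup>2 \<le> - (\<mu> * blinfun_apply (b - c) (y - z))"
    using g unfolding strongly_convex_def by (metis blinfun.minus_left blinfun.scaleR_left real_scaleR_def)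
  moreover have "0 \<le> blinfun_apply (b - c) (y - z)"
    using B b(1) c(1) unfolding monotone_operator_def by blast
  ultimately have "\<gamma> * (norm (y - z))\<^sup>2 \<le> 0"
    using \<open>\<mu> > 0\<close> by (smt (verit) mult_nonneg_nonneg)
  then show ?thesis
    using \<open>\<gamma> > 0\<close> by (simp add: mult_le_0_iff)
qed

text \<open>Existence and uniqueness make the set a singleton, where \<open>the_elem\<close> has its
  intended value.\<close>

lemma resolvent_mem_resolvent_set:
  assumes "resolvent_set g \<mu> B x \<noteq> {}"
    and "\<And>y z. y \<in> resolvent_set g \<mu> B x \<Longrightarrow> z \<in> resolvent_set g \<mu> B x \<Longrightarrow> y = z"
  shows "resolvent g \<mu> B x \<in> resolvent_set g \<mu> B x"
proof -
  obtain z where "resolvent_set g \<mu> B x = {z}"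
    using assms by blast
  then show ?thesis
    by (simp add: resolvent_def)
qed

section \<open>Bregman distances and the decrease of the Lyapunov function\<close>

definition bregman :: "('a::real_normed_vector \<Rightarrow> real) \<Rightarrow> 'a \<Rightarrow> 'a \<Rightarrow> real" where
  "bregman g x y = g x - g y - blinfun_apply (grad g y) (x - y)"

text \<open>Here \<open>z\<close> and \<open>x\<close> stand for the consecutive iterates \<open>v\<^sub>n\<^sub>-\<^sub>1\<close> and \<open>v\<^sub>n\<close>.\<close>

definition lyapunov ::
    "('a::real_normed_vector \<Rightarrow> real) \<Rightarrow> ('a \<Rightarrow> ('a \<Rightarrow>\<^sub>L real)) \<Rightarrow> real \<Rightarrow> real \<Rightarrow> 'a \<Rightarrow> 'a \<Rightarrow> 'a \<Rightarrow> real" where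
  "lyapunov g A \<mu> L u z x =
     bregman g u x - \<mu> * blinfun_apply (A x - A z) (x - u) + \<mu> * L / 2 * (norm (x - z))\<^sup>2"

lemma lipschitz_pairing_le:
  fixes A :: "'a::real_normed_vector \<Rightarrow> ('a \<Rightarrow>\<^sub>L real)"
  assumes A: "L-lipschitz_on UNIV A" and "0 \<le> \<mu>"
  shows "\<mu> * \<bar>blinfun_apply (A x - A z) y\<bar> \<le> \<mu> * L / 2 * (norm (x - z))\<^sup>2 + \<mu> * L / 2 * (norm y)\<^sup>2"
proof -
  have L: "0 \<le> L"
    using A lipschitz_on_nonneg by blast
  have "\<bar>blinfun_apply (A x - A z) y\<bar> \<le> norm (A x - A z) * norm y"
    using norm_blinfun[of "A x - A z" y] by simp
  also have "\<dots> \<le> L * norm (x - z) * norm y"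
    using lipschitz_onD[OF A, of x z] by (intro mult_right_mono) (simp_all add: dist_norm)
  also have "\<dots> \<le> L * (((norm (x - z))\<^sup>2 + (norm y)\<^sup>2) / 2)"
    using L sum_squares_bound[of "norm (x - z)" "norm y"]
    by (simp add: mult.assoc mult_left_mono)
  finally have "\<mu> * \<bar>blinfun_apply (A x - A z) y\<bar> \<le> \<mu> * (L * (((norm (x - z))\<^sup>2 + (norm y)\<^sup>2) / 2))"
    using \<open>0 \<le> \<mu>\<close> by (rule mult_left_mono)
  then show ?thesis
    by (simp add: field_simps)
qed

text \<open>The pairing splits into two squares: one is cancelled by the last term of
  \<open>lyapunov\<close>, the other is absorbed by the Bregman distance.\<close>

lemma lyapunov_nonneg:
  fixes g :: "'a::real_normed_vector \<Rightarrow> real"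
  assumes A: "L-lipschitz_on UNIV A" and "0 \<le> \<mu>" and "\<mu> * L \<le> \<gamma>"
    and gap: "\<gamma> / 2 * (norm (u - x))\<^sup>2 \<le> bregman g u x"
  shows "0 \<le> lyapunov g A \<mu> L u z x"
proof -
  have "\<mu> * blinfun_apply (A x - A z) (x - u) \<le> \<mu> * \<bar>blinfun_apply (A x - A z) (x - u)\<bar>"
    using \<open>0 \<le> \<mu>\<close> by (simp add: mult_left_mono)
  also have "\<dots> \<le> \<mu> * L / 2 * (norm (x - z))\<^sup>2 + \<mu> * L / 2 * (norm (u - x))\<^sup>2"
    using lipschitz_pairing_le[OF A \<open>0 \<le> \<mu>\<close>, of x z "x - u"] by (simp add: norm_minus_commute)
  finally have "\<mu> * blinfun_apply (A x - A z) (x - u)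
      \<le> \<mu> * L / 2 * (norm (x - z))\<^sup>2 + \<mu> * L / 2 * (norm (u - x))\<^sup>2" .
  moreover have "\<mu> * L / 2 * (norm (u - x))\<^sup>2 \<le> \<gamma> / 2 * (norm (u - x))\<^sup>2"
    using \<open>\<mu> * L \<le> \<gamma>\<close> by (intro mult_right_mono) auto
  ultimately show ?thesis
    unfolding lyapunov_def using gap by linarith
qed

text \<open>Here \<open>w\<close> is the next iterate. The pairings with \<open>x - u\<close> and
  \<open>w - u\<close> telescope, leaving a cross term with \<open>w - x\<close>. Splitting it costs
  \<open>\<mu> * L / 2\<close> times the square of \<open>norm (w - x)\<close>; the new Lyapunov
  value needs as much again, and \<open>step\<close> lets \<open>bregman g w x\<close> pay for
  both.\<close>

lemma lyapunov_decrease: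
  fixes g :: "'a::real_normed_vector \<Rightarrow> real"
  assumes A: "L-lipschitz_on UNIV A" and "0 \<le> \<mu>" and step: "\<mu> * L \<le> \<gamma> / 2"
    and gap: "\<gamma> / 2 * (norm (w - x))\<^sup>2 \<le> bregman g w x"
    and eq: "grad g x - \<mu> *\<^sub>R (2 *\<^sub>R A x - A z) = grad g w + \<mu> *\<^sub>R b"
    and mono: "\<tau> * (norm (w - u))\<^sup>2 \<le> blinfun_apply (A w + b) (w - u)"
  shows "lyapunov g A \<mu> L u x w + \<mu> * \<tau> * (norm (w - u))\<^sup>2 \<le> lyapunov g A \<mu> L u z x"
proof -
  have "\<mu> * (\<tau> * (norm (w - u))\<^sup>2) \<le> \<mu> * blinfun_apply (A w + b) (w - u)"
    using mono \<open>0 \<le> \<mu>\<close> by (rule mult_left_mono)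
  also have "\<dots> = blinfun_apply (\<mu> *\<^sub>R A w + \<mu> *\<^sub>R b) (w - u)"
    by (simp add: blinfun.bilinear_simps algebra_simps)
  also have "\<mu> *\<^sub>R b = grad g x - \<mu> *\<^sub>R (2 *\<^sub>R A x - A z) - grad g w"
    using eq by (simp add: algebra_simps)
  \<comment> \<open>The three-point identity for the gradients, with \<open>w - u\<close> split as
    \<open>(x - u) + (w - x)\<close> in the old difference of \<open>A\<close>.\<close>
  also have "blinfun_apply (\<mu> *\<^sub>R A w + (grad g x - \<mu> *\<^sub>R (2 *\<^sub>R A x - A z) - grad g w)) (w - u)
      = bregman g u x - bregman g u w - bregman g w x
        + \<mu> * blinfun_apply (A w - A x) (w - u) - \<mu> * blinfun_apply (A x - A z) (x - u)
        - \<mu> * blinfun_apply (A x - A z) (w - x)"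
    by (simp add: bregman_def blinfun.bilinear_simps algebra_simps)
  finally have "\<mu> * (\<tau> * (norm (w - u))\<^sup>2) \<le> bregman g u x - bregman g u w - bregman g w x
        + \<mu> * blinfun_apply (A w - A x) (w - u) - \<mu> * blinfun_apply (A x - A z) (x - u)
        - \<mu> * blinfun_apply (A x - A z) (w - x)" .
  moreover have "- (\<mu> * blinfun_apply (A x - A z) (w - x))
      \<le> \<mu> * L / 2 * (norm (x - z))\<^sup>2 + \<mu> * L / 2 * (norm (w - x))\<^sup>2"
  proof -
    have "- (\<mu> * blinfun_apply (A x - A z) (w - x)) \<le> \<bar>\<mu> * blinfun_apply (A x - A z) (w - x)\<bar>"
      by simp
    then show ?thesis
      using lipschitz_pairing_le[OF A \<open>0 \<le> \<mu>\<close>, of x z "w - x"] \<open>0 \<le> \<mu>\<close> by (simp add: abs_mult)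
  qed
  moreover have "\<mu> * L * (norm (w - x))\<^sup>2 \<le> \<gamma> / 2 * (norm (w - x))\<^sup>2"
    using step by (intro mult_right_mono) auto
  ultimately show ?thesis
    unfolding lyapunov_def using gap by (simp add: algebra_simps)
qed

text \<open>A decreasing nonnegative \<open>e\<close> converges, so its consecutive differences,
  which dominate \<open>c * a n\<close>, vanish.\<close>

lemma tendsto_zero_of_telescoping:
  fixes e a :: "nat \<Rightarrow> real"
  assumes "c > 0" and e: "\<And>n. 0 \<le> e n" and a: "\<And>n. 0 \<le> a n" and dec: "\<And>n. e (Suc n) + c * a n \<le> e n"
  shows "a \<longlonglongrightarrow> 0"
proof -
  have "e (Suc n) \<le> e n" for n
    using dec[of n] a[of n] \<open>c > 0\<close> by (smt (verit) mult_nonneg_nonneg)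
  then have "decseq e"
    by (simp add: decseq_Suc_iff)
  then obtain l where l: "e \<longlonglongrightarrow> l"
    using decseq_convergent e by metis
  have "(\<lambda>n. (e n - e (Suc n)) / c) \<longlonglongrightarrow> (l - l) / c"
    using \<open>c > 0\<close> l by (intro tendsto_intros LIMSEQ_Suc) auto
  then have "(\<lambda>n. (e n - e (Suc n)) / c) \<longlonglongrightarrow> 0"
    by simp
  moreover have "a n \<le> (e n - e (Suc n)) / c" for n
    using dec[of n] \<open>c > 0\<close> by (simp add: field_simps)
  ultimately show ?thesis
    using tendsto_sandwich[of "\<lambda>_. 0" a sequentially "\<lambda>n. (e n - e (Suc n)) / c" 0] a by simp
qed

theorem theorem4p13:
  fixes g :: "'a::banach \<Rightarrow> real"
    and A :: "'a \<Rightarrow> ('a \<Rightarrow>\<^sub>L real)"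
    and B :: "'a \<Rightarrow> ('a \<Rightarrow>\<^sub>L real) set"
    and \<gamma> L \<tau> \<delta> \<mu> :: real
    and v :: "nat \<Rightarrow> 'a"
  assumes "reflexive_space TYPE('a)"
    and "proper_function (\<lambda>x. ereal (g x))"
    and "convex_on UNIV g"
    and "lower_semicontinuous (\<lambda>x. ereal (g x))"
    and "uniformly_frechet_differentiable g"
    and "\<gamma> > 0" and "strongly_convex \<gamma> g"
    and "strongly_coercive g"
    and "legendre (\<lambda>x. ereal (g x))"
    and "L > 0" and "L-lipschitz_on UNIV A"
    and "\<tau> > 0"
    and "(monotone_mapping A \<and> maximal_monotone B \<and> strongly_monotone_operator \<tau> B) \<or>
         (strongly_monotone_mapping \<tau> A \<and> maximal_monotone B)"
    and "zeros_of_sum A B \<noteq> {}"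
    and "\<delta> \<in> {0<..<1/2}"
    and "\<mu> \<in> {\<delta> .. \<gamma> * (1 - 2 * \<delta>) / (2 * L)}"
    and "\<And>n. n \<ge> 1 \<Longrightarrow>
           v (n + 1) = resolvent g \<mu> B
             (grad_conj g (grad g (v n) - \<mu> *\<^sub>R (2 *\<^sub>R A (v n) - A (v (n - 1)))))"
  shows "\<exists>u \<in> zeros_of_sum A B. v \<longlonglongrightarrow> u"
proof -
  note refl = assms(1) and frechet = assms(5) and \<gamma> = \<open>\<gamma> > 0\<close> and convex = \<open>strongly_convex \<gamma> g\<close>
    and A = \<open>L-lipschitz_on UNIV A\<close> and \<tau> = \<open>\<tau> > 0\<close>
  have B: "maximal_monotone B"
    using assms(13) by blast
  have \<mu>: "\<mu> > 0"
    using assms(15,16) by auto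
  have "\<mu> * L \<le> \<gamma> * (1 - 2 * \<delta>) / 2"
    using assms(16) \<open>L > 0\<close> by (simp add: field_simps)
  also have "\<dots> \<le> \<gamma> / 2"
    using assms(15) \<gamma> by simp
  finally have step: "\<mu> * L \<le> \<gamma> / 2" .
  have diff: "gateaux_differentiable_at (\<lambda>x. ereal (g x)) x" for x
    using frechet unfolding uniformly_frechet_differentiable_def by blast
  note gap = strongly_convex_gap[OF diff convex]
  have gap': "\<gamma> / 2 * (norm (x - y))\<^sup>2 \<le> bregman g x y" for x y
    using gap[of y x] by (simp add: bregman_def)
  have grad_conj: "grad g (grad_conj g \<xi>) = \<xi>" for \<xi>
    using \<gamma> by (intro grad_grad_conj[OF refl diff assms(9) _ gap]) simp
  have res: "resolvent g \<mu> B x \<in> resolvent_set g \<mu> B x" for x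
  proof (rule resolvent_mem_resolvent_set)
    show "resolvent_set g \<mu> B x \<noteq> {}"
      \<comment> \<open>Surjectivity of \<open>grad g\<close> holds because
        \<open>grad_conj g\<close> is a right inverse.\<close>
      using \<gamma> \<mu> by (intro resolvent_set_nonempty[OF refl B _ _ gap])
        (simp_all add: surjI[of "grad g", OF grad_conj] uniformly_frechet_locally_bounded[OF frechet])
    show "y = z" if "y \<in> resolvent_set g \<mu> B x" "z \<in> resolvent_set g \<mu> B x" for y z
      using that B convex \<gamma> \<mu> resolvent_set_unique unfolding maximal_monotone_def by blast
  qed
  obtain u where u: "u \<in> zeros_of_sum A B"
    using assms(14) by blast
  then obtain bu where bu: "bu \<in> B u" "A u + bu = 0"
    unfolding zeros_of_sum_def by auto
  have mono: "\<tau> * (norm (w - u))\<^sup>2 \<le> blinfun_apply (A w + b) (w - u)" if b: "b \<in> B w" for w b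
  proof -
    \<comment> \<open>Subtracting \<open>A u + bu = 0\<close> splits the pairing into a part for
      \<open>A\<close> and a part for \<open>B\<close>; in either case one part supplies
      \<open>\<tau>\<close> and the other is nonnegative.\<close>
    have "A w + b = (A w - A u) + (b - bu)"
      using bu(2) by (simp add: algebra_simps)
    then have sum: "blinfun_apply (A w + b) (w - u)
        = blinfun_apply (A w - A u) (w - u) + blinfun_apply (b - bu) (w - u)"
      by (metis blinfun.add_left)
    from assms(13) show ?thesis
    proof
      assume "monotone_mapping A \<and> maximal_monotone B \<and> strongly_monotone_operator \<tau> B"
      then have "0 \<le> blinfun_apply (A w - A u) (w - u)"
        "\<tau> * (norm (w - u))\<^sup>2 \<le> blinfun_apply (b - bu) (w - u)"
        using b bu(1) unfolding monotone_mapping_def strongly_monotone_operator_def by blast+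
      then show ?thesis
        unfolding sum by simp
    next
      assume "strongly_monotone_mapping \<tau> A \<and> maximal_monotone B"
      then have "\<tau> * (norm (w - u))\<^sup>2 \<le> blinfun_apply (A w - A u) (w - u)"
        "0 \<le> blinfun_apply (b - bu) (w - u)"
        using b bu(1)
        unfolding strongly_monotone_mapping_def maximal_monotone_def monotone_operator_def by blast+
      then show ?thesis
        unfolding sum by simp
    qed
  qed
  \<comment> \<open>Indexed from the pair \<open>v 0\<close>, \<open>v 1\<close>, so the step from
    \<open>e n\<close> uses the recursion at \<open>Suc n\<close> and controls
    \<open>v (Suc (Suc n))\<close>.\<close>
  define e where "e n = lyapunov g A \<mu> L u (v n) (v (Suc n))" for n
  have "e (Suc n) + \<mu> * \<tau> * (norm (v (Suc (Suc n)) - u))\<^sup>2 \<le> e n" for n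
  proof -
    let ?\<xi> = "grad g (v (Suc n)) - \<mu> *\<^sub>R (2 *\<^sub>R A (v (Suc n)) - A (v n))"
    have "v (Suc (Suc n)) = resolvent g \<mu> B (grad_conj g ?\<xi>)"
      using assms(17)[of "Suc n"] by simp
    then have "v (Suc (Suc n)) \<in> resolvent_set g \<mu> B (grad_conj g ?\<xi>)"
      using res by simp
    \<comment> \<open>The outer \<open>grad g\<close> cancels \<open>grad_conj g\<close>, which
      turns membership in the resolvent set into the equation required by
      \<open>lyapunov_decrease\<close>.\<close>
    then obtain b where "b \<in> B (v (Suc (Suc n)))" "?\<xi> = grad g (v (Suc (Suc n))) + \<mu> *\<^sub>R b"
      unfolding resolvent_set_def grad_conj by blast
    then show ?thesis
      unfolding e_def using lyapunov_decrease[OF A _ step gap'] mono \<mu> by simp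
  qed
  moreover have "0 \<le> e n" for n
    unfolding e_def using \<mu> step \<gamma> by (intro lyapunov_nonneg[OF A _ _ gap']) auto
  ultimately have "(\<lambda>n. (norm (v (Suc (Suc n)) - u))\<^sup>2) \<longlonglongrightarrow> 0"
    using \<mu> \<tau> by (intro tendsto_zero_of_telescoping[of "\<mu> * \<tau>" e]) auto
  then have "(\<lambda>n. sqrt ((norm (v (Suc (Suc n)) - u))\<^sup>2)) \<longlonglongrightarrow> sqrt 0"
    by (rule tendsto_real_sqrt)
  then have "(\<lambda>n. norm (v (Suc (Suc n)) - u)) \<longlonglongrightarrow> 0"
    by simp
  then have "(\<lambda>n. v (Suc (Suc n))) \<longlonglongrightarrow> u"
    by (simp add: LIM_zero_iff tendsto_norm_zero_iff)
  then have "v \<longlonglongrightarrow> u"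
    by (rule LIMSEQ_imp_Suc[OF LIMSEQ_imp_Suc])
  with u show ?thesis
    by blast
qed

end
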